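(* Let $p\ge 1$ be an integer and $L>0$. Let $F:\mathbb{R}^d\to\mathbb{R}^d$ be monotone and $p$-th-order strongly Lipschitz continuous with constant $L$, and suppose that $F(x)=0$ has at least one solution. Let $c_p=\sum_{m=1}^p\frac{1}{m!}$, let $0<\gamma<\min\{1,\frac{1}{2Lc_p}\}$, and let the constant $\eta_2=\eta_2(p,L,\gamma)$ satisfy $$\frac{\gamma^p}{6-6\gamma Lc_p}\le\eta_2\le\frac{\gamma^p}{2+2\gamma Lc_p}.$$ Then for any $x_0\in\mathbb{R}^d$ the iterates $\{x_k\}_{k\ge0}$ generated by the first-order method described in the context satisfy $$\inf_{0\le i\le k}\|F(x_i)\|=O(k^{-p/2}),$$ i.e., there is a constant $C>0$ independent of $k$ with $\inf_{0\le i\le k}\|F(x_i)\|\le Ck^{-p/2}$ for all $k\ge1$.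
   Context: $\|\cdot\|$ is the Euclidean norm (and the operator norm for multilinear maps). $F$ is monotone if $\langle F(x)-F(y),x-y\rangle\ge0$ for all $x,y$. $D^{(j)}F(x)$ is the $j$-th derivative of $F$ at $x$, with $D^{(0)}F=F$; $D^{(j)}F(x)[h]^j\in\mathbb{R}^d$ denotes its value at $(h,\ldots,h)$. $F$ is $p$-th-order strongly Lipschitz continuous with constant $L$ if it is $(p-1)$ times differentiable, $\|D^{(p-1)}F(x')-D^{(p-1)}F(x)\|\le L\|x'-x\|$ for all $x,x'$, and $\|D^{(m)}F(x)[F(x)]^m\|\le L\|F(x)\|^{m+1-m/p}$ for all $x$ and all $1\le m\le p-1$. First-order method: given $x_0\in\mathbb{R}^d$, set $s_0=0$. For $k=0,1,2,\ldots$: if $F(x_k)=0$, stop; otherwise set $v_{k+1}=x_0+s_k$; set $x_{k+1}=v_{k+1}-\gamma\|F(v_{k+1})\|^{1/p-1}F(v_{k+1})$; set $\lambda_{k+1}=\eta_2/\|x_{k+1}-v_{k+1}\|^{p-1}$ and $s_{k+1}=s_k-\lambda_{k+1}F(x_{k+1})$. Conventions: if the method stops at $x_j$ with $F(x_j)=0$, the infimum for $k\ge j$ is taken over $x_0,\ldots,x_j$ (so it is $0$). If $F(v_{k+1})=0$ then $x_{k+1}=v_{k+1}$ and the method stops at $x_{k+1}$. For $p=1$, $\|x_{k+1}-v_{k+1}\|^{p-1}=1$. *)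

theory Defs
  imports "HOL-Analysis.Analysis"
begin

section \<open>Multilinear maps and higher derivatives\<close>

text \<open>
  An \<open>n\<close>-linear map is represented by a function on lists, of which only the values at lists of
  length \<open>n\<close> matter.
\<close>

definition multilinear :: "nat \<Rightarrow> ('a::real_vector list \<Rightarrow> 'b::real_vector) \<Rightarrow> bool" where
  "multilinear n T \<longleftrightarrow> (\<forall>hs i. length hs = n \<longrightarrow> i < n \<longrightarrow> linear (\<lambda>h. T (hs[i := h])))"

text \<open>
  The supremum is over a bounded set for every multilinear map on a finite-dimensional space.
  For \<open>n = 0\<close> it is \<open>norm (T [])\<close>.
\<close>

definition multi_onorm :: "nat \<Rightarrow> ('a::euclidean_space list \<Rightarrow> 'b::real_normed_vector) \<Rightarrow> real" where
  "multi_onorm n T = (SUP hs \<in> {hs. length hs = n \<and> (\<forall>h\<in>set hs. norm h \<le> 1)}. norm (T hs))"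

text \<open>
  \<open>nth_deriv F j x [h\<^sub>1, \<dots>, h\<^sub>j]\<close> is the value of the \<open>j\<close>-th derivative of \<open>F\<close> at \<open>x\<close>. The head of
  the list is the direction of the last differentiation:
  \<open>D\<^bsup>(j+1)\<^esup>F(x)[h, h\<^sub>1, \<dots>, h\<^sub>j] = (D(D\<^bsup>(j)\<^esup>F)(x)[h])[h\<^sub>1, \<dots>, h\<^sub>j]\<close>. It is meaningful under
  \<open>times_differentiable\<close> below.
\<close>

primrec nth_deriv :: "('a::euclidean_space \<Rightarrow> 'b::real_normed_vector) \<Rightarrow> nat \<Rightarrow> 'a \<Rightarrow> 'a list \<Rightarrow> 'b" where
  "nth_deriv F 0 x hs = F x"
| "nth_deriv F (Suc j) x hs = frechet_derivative (\<lambda>y. nth_deriv F j y (tl hs)) (at x) (hd hs)"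

text \<open>
  \<open>F\<close> is \<open>k\<close> times differentiable on the whole space: for \<open>j < k\<close>, the map \<open>x \<mapsto> D\<^bsup>(j)\<^esup>F(x)\<close> into the
  \<open>j\<close>-linear maps, normed by \<open>multi_onorm j\<close>, is Frechet differentiable with derivative
  \<open>D\<^bsup>(j+1)\<^esup>F\<close>.
\<close>

definition times_differentiable :: "nat \<Rightarrow> ('a::euclidean_space \<Rightarrow> 'b::real_normed_vector) \<Rightarrow> bool" where
  "times_differentiable k F \<longleftrightarrow>
     (\<forall>j<k. \<forall>x. multilinear (Suc j) (nth_deriv F (Suc j) x) \<and>
        ((\<lambda>h. multi_onorm j (\<lambda>hs. nth_deriv F j (x + h) hs - nth_deriv F j x hs
                                   - nth_deriv F (Suc j) x (h # hs)) / norm h) \<longlongrightarrow> 0) (at 0))"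

section \<open>The operator class\<close>

definition monotone_operator :: "('a::real_inner \<Rightarrow> 'a) \<Rightarrow> bool" where
  "monotone_operator F \<longleftrightarrow> (\<forall>x y. (F x - F y) \<bullet> (x - y) \<ge> 0)"

definition strongly_lipschitz :: "nat \<Rightarrow> real \<Rightarrow> ('a::euclidean_space \<Rightarrow> 'a) \<Rightarrow> bool" where
  "strongly_lipschitz p L F \<longleftrightarrow>
     times_differentiable (p - 1) F \<and>
     (\<forall>x x'. multi_onorm (p - 1) (\<lambda>hs. nth_deriv F (p - 1) x' hs - nth_deriv F (p - 1) x hs)
               \<le> L * norm (x' - x)) \<and>
     (\<forall>x. \<forall>m\<in>{1..p - 1}. norm (nth_deriv F m x (replicate m (F x)))
               \<le> L * norm (F x) powr (real m + 1 - real m / real p))"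

section \<open>The first-order method\<close>

text \<open>
  The state after \<open>k\<close> steps is \<open>(x\<^sub>k, s\<^sub>k)\<close>. Once \<open>F x\<^sub>j = 0\<close> the state is frozen, so that
  \<open>{x\<^sub>i | i \<le> k} = {x\<^sub>0, \<dots>, x\<^sub>j}\<close> for \<open>k \<ge> j\<close>. If \<open>F v = 0\<close>, the step gives \<open>x' = v\<close> (the factor
  \<open>0 powr _\<close> is \<open>0\<close>), the quotient in \<open>l\<close> is irrelevant because \<open>F x' = 0\<close>, and the method stops at \<open>x'\<close>.
\<close>

definition fom_step ::
    "nat \<Rightarrow> real \<Rightarrow> real \<Rightarrow> ('a::euclidean_space \<Rightarrow> 'a) \<Rightarrow> 'a \<Rightarrow> 'a \<times> 'a \<Rightarrow> 'a \<times> 'a" where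
  "fom_step p \<gamma> \<eta> F x0 = (\<lambda>(x, s).
     if F x = 0 then (x, s)
     else let v = x0 + s;
              x' = v - (\<gamma> * norm (F v) powr (1 / real p - 1)) *\<^sub>R F v;
              l = \<eta> / norm (x' - v) ^ (p - 1)
          in (x', s - l *\<^sub>R F x'))"

primrec fom_state ::
    "nat \<Rightarrow> real \<Rightarrow> real \<Rightarrow> ('a::euclidean_space \<Rightarrow> 'a) \<Rightarrow> 'a \<Rightarrow> nat \<Rightarrow> 'a \<times> 'a" where
  "fom_state p \<gamma> \<eta> F x0 0 = (x0, 0)"
| "fom_state p \<gamma> \<eta> F x0 (Suc k) = fom_step p \<gamma> \<eta> F x0 (fom_state p \<gamma> \<eta> F x0 k)"

definition fom_iterate ::
    "nat \<Rightarrow> real \<Rightarrow> real \<Rightarrow> ('a::euclidean_space \<Rightarrow> 'a) \<Rightarrow> 'a \<Rightarrow> nat \<Rightarrow> 'a" where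
  "fom_iterate p \<gamma> \<eta> F x0 k = fst (fom_state p \<gamma> \<eta> F x0 k)"

definition c_const :: "nat \<Rightarrow> real" where
  "c_const p = (\<Sum>m=1..p. 1 / fact m)"

end

theory Submission
  imports Defs
begin

text \<open>
  Put \<open>v = v\<^bsub>k+1\<^esub>\<close>, \<open>x = x\<^bsub>k+1\<^esub>\<close>, \<open>\<lambda> = \<lambda>\<^bsub>k+1\<^esub>\<close>, \<open>a = \<gamma> L c\<^sub>p\<close>, \<open>\<theta> = \<eta>\<^sub>2 / \<gamma>\<^sup>p\<close> and
  \<open>r = \<parallel>x - v\<parallel> = \<gamma> \<parallel>F v\<parallel>\<^bsup>1/p\<^esup>\<close>. Along the step \<open>x - v\<close> the bound on \<open>D\<^bsup>(m)\<^esup>F(v)[F v]\<^sup>m\<close>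
  makes the \<open>m\<close>-th Taylor term of size at most \<open>\<gamma>\<^sup>m L \<parallel>F v\<parallel> / m!\<close>, and so is the remainder for \<open>m = p\<close>.
  Hence \<open>\<parallel>F x - F v\<parallel> \<le> a \<parallel>F v\<parallel>\<close> with \<open>a < 1/2\<close>. Since \<open>\<lambda> F v = \<theta> (v - x)\<close>, the vector
  \<open>\<lambda> F x\<close> agrees with \<open>\<theta> (v - x)\<close> up to an error of norm \<open>\<theta> a r\<close>, and monotonicity yields, for every zero
  \<open>z\<close> of \<open>F\<close>,
  \<open>\<parallel>v\<^bsub>k+2\<^esub> - z\<parallel>\<^sup>2 \<le> \<parallel>v\<^bsub>k+1\<^esub> - z\<parallel>\<^sup>2 - \<theta> r\<^sup>2 / 4\<close>. So the squared step lengths are summable, the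
  least of the first \<open>k\<close> of them is \<open>O(1/k)\<close>, and \<open>\<parallel>F x\<parallel> \<le> (1 + a) (r / \<gamma>)\<^sup>p\<close>.
\<close>

section \<open>Multilinear maps on lists and their operator norm\<close>

lemma multilinear_head:
  assumes "multilinear (Suc n) T" and "length hs = n"
  shows "linear (\<lambda>h. T (h # hs))"
proof -
  have "linear (\<lambda>h. T ((0 # hs)[0 := h]))"
    using assms unfolding multilinear_def by (metis length_Cons zero_less_Suc)
  then show ?thesis by simp
qed

lemma multilinear_tail:
  assumes "multilinear (Suc n) T"
  shows "multilinear n (\<lambda>hs. T (h # hs))"
  unfolding multilinear_def
proof (intro allI impI)
  fix hs :: "'a list" and i
  assume "length hs = n" "i < n"
  then have "linear (\<lambda>g. T ((h # hs)[Suc i := g]))"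
    using assms unfolding multilinear_def by (metis length_Cons Suc_less_eq)
  then show "linear (\<lambda>g. T (h # hs[i := g]))" by simp
qed

lemma multilinear_diff:
  assumes "multilinear n S" and "multilinear n T"
  shows "multilinear n (\<lambda>hs. S hs - T hs)"
  using assms unfolding multilinear_def by (auto intro: linear_compose_sub)

lemma multilinear_map_scaleR:
  assumes "multilinear n T" and "length hs = n"
  shows "T (map ((*\<^sub>R) c) hs) = c ^ n *\<^sub>R T hs"
  using assms
proof (induction n arbitrary: T hs)
  case (Suc n)
  then obtain h hs' where hs: "hs = h # hs'" and len: "length hs' = n"
    by (metis length_Suc_conv)
  have "T (map ((*\<^sub>R) c) hs) = c ^ n *\<^sub>R T ((c *\<^sub>R h) # hs')"
    using Suc.IH[OF multilinear_tail[OF Suc.prems(1)] len] by (simp add: hs)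
  also have "T ((c *\<^sub>R h) # hs') = c *\<^sub>R T (h # hs')"
    using linear_scale[OF multilinear_head[OF Suc.prems(1) len]] by simp
  finally show ?case by (simp add: hs mult.commute)
qed simp

text \<open>Expanding the head of the list in the basis reduces the claim to the finitely many maps
  \<open>T (b # _)\<close>, bounded by induction; unit vectors have coordinates of size at most 1.
  This makes the supremum in \<open>multi_onorm\<close> one over a bounded set, hence a genuine
  upper bound.\<close>

lemma multilinear_bounded:
  fixes T :: "'a::euclidean_space list \<Rightarrow> 'b::real_normed_vector"
  assumes "multilinear n T"
  shows "\<exists>B. \<forall>hs. length hs = n \<longrightarrow> (\<forall>h\<in>set hs. norm h \<le> 1) \<longrightarrow> norm (T hs) \<le> B"
  using assms
proof (induction n arbitrary: T)
  case 0
  then show ?case by auto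
next
  case (Suc n)
  have "\<forall>b. \<exists>B. \<forall>hs. length hs = n \<longrightarrow> (\<forall>h\<in>set hs. norm h \<le> 1) \<longrightarrow> norm (T (b # hs)) \<le> B"
    using Suc.IH[OF multilinear_tail[OF Suc.prems]] by blast
  then obtain B where B: "\<And>b hs. \<lbrakk>length hs = n; \<forall>h\<in>set hs. norm h \<le> 1\<rbrakk> \<Longrightarrow> norm (T (b # hs)) \<le> B b"
    by metis
  have "norm (T hs) \<le> (\<Sum>b\<in>Basis. B b)"
    if len: "length hs = Suc n" and unit: "\<forall>h\<in>set hs. norm h \<le> 1" for hs
  proof -
    obtain h hs' where hs: "hs = h # hs'" and len': "length hs' = n"
      using len by (metis length_Suc_conv)
    interpret linear "\<lambda>h. T (h # hs')" by (rule multilinear_head[OF Suc.prems len'])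
    have "T (h # hs') = T ((\<Sum>b\<in>Basis. (h \<bullet> b) *\<^sub>R b) # hs')"
      by (simp add: euclidean_representation)
    also have "\<dots> = (\<Sum>b\<in>Basis. (h \<bullet> b) *\<^sub>R T (b # hs'))"
      by (simp add: sum scale)
    also have "norm \<dots> \<le> (\<Sum>b\<in>Basis. B b)"
    proof (rule sum_norm_le)
      fix b :: 'a
      assume "b \<in> Basis"
      then have "\<bar>h \<bullet> b\<bar> \<le> 1" using unit Basis_le_norm[of b h] by (simp add: hs)
      moreover have "norm (T (b # hs')) \<le> B b" using B len' unit hs by simp
      ultimately show "norm ((h \<bullet> b) *\<^sub>R T (b # hs')) \<le> B b"
        using mult_mono[of "\<bar>h \<bullet> b\<bar>" 1 "norm (T (b # hs'))" "B b"] by simp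
    qed
    finally show ?thesis by (simp add: hs)
  qed
  then show ?case by blast
qed

lemma norm_le_multi_onorm:
  fixes T :: "'a::euclidean_space list \<Rightarrow> 'b::real_normed_vector"
  assumes "multilinear n T" and "length hs = n" and "\<And>h. h \<in> set hs \<Longrightarrow> norm h \<le> 1"
  shows "norm (T hs) \<le> multi_onorm n T"
  unfolding multi_onorm_def
proof (rule cSUP_upper)
  obtain B where "\<forall>hs. length hs = n \<longrightarrow> (\<forall>h\<in>set hs. norm h \<le> 1) \<longrightarrow> norm (T hs) \<le> B"
    using multilinear_bounded[OF assms(1)] by blast
  then show "bdd_above ((\<lambda>hs. norm (T hs)) ` {hs. length hs = n \<and> (\<forall>h\<in>set hs. norm h \<le> 1)})"
    by (intro bdd_aboveI2) auto
qed (use assms in auto)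

section \<open>Higher derivatives, Taylor's bound, and the change of \<open>F\<close> along one
  step\<close>

lemma multilinear_nth_deriv:
  assumes "times_differentiable k F" and "j \<le> k"
  shows "multilinear j (nth_deriv F j x)"
proof (cases j)
  case 0
  then show ?thesis by (simp add: multilinear_def)
next
  case (Suc i)
  then show ?thesis using assms unfolding times_differentiable_def by auto
qed

text \<open>Differentiability in operator norm gives differentiability at each fixed argument list
  by comparison of remainders. Arguments in the unit ball make this comparison direct, without
  rescaling.\<close>

lemma has_derivative_nth_deriv:
  fixes F :: "'a::euclidean_space \<Rightarrow> 'b::real_normed_vector"
  assumes diff: "times_differentiable k F" and j: "j < k"
    and len: "length hs = j" and unit: "\<And>h. h \<in> set hs \<Longrightarrow> norm h \<le> 1"
  shows "((\<lambda>y. nth_deriv F j y hs) has_derivative (\<lambda>h. nth_deriv F (Suc j) x (h # hs))) (at x)"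
proof -
  let ?R = "\<lambda>h hs. nth_deriv F j (x + h) hs - nth_deriv F j x hs - nth_deriv F (Suc j) x (h # hs)"
  have ml: "multilinear (Suc j) (nth_deriv F (Suc j) x)"
    using multilinear_nth_deriv[OF diff, of "Suc j"] j by simp
  have le: "norm (?R h hs) \<le> multi_onorm j (?R h)" for h
    using multilinear_nth_deriv[OF diff, of j] j
    by (intro norm_le_multi_onorm multilinear_diff multilinear_tail[OF ml] len unit) auto
  have "((\<lambda>h. multi_onorm j (?R h) / norm h) \<longlongrightarrow> 0) (at 0)"
    using diff j unfolding times_differentiable_def by blast
  then have "((\<lambda>h. norm (?R h hs) / norm h) \<longlongrightarrow> 0) (at 0)"
    by (rule Lim_null_comparison[rotated]) (auto intro!: always_eventually divide_right_mono le simp del: nth_deriv.simps)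
  then show ?thesis
    unfolding has_derivative_at using linear_conv_bounded_linear multilinear_head[OF ml len] by blast
qed

text \<open>Induction on the order: differentiating the remainder of \<open>g\<close> gives the
  remainder of one order less for the shifted family \<open>g (Suc m)\<close>, and the mean value
  inequality integrates its bound. The base case is the Lipschitz hypothesis itself.\<close>

lemma vector_taylor_bound:
  fixes g :: "nat \<Rightarrow> real \<Rightarrow> 'b::real_normed_vector"
  assumes "\<And>m t. m < q \<Longrightarrow> (g m has_vector_derivative g (Suc m) t) (at t)"
    and "\<And>t. 0 \<le> t \<Longrightarrow> norm (g q t - g q 0) \<le> L * t"
    and "0 \<le> t"
  shows "norm (g 0 t - (\<Sum>m\<le>q. (t ^ m / fact m) *\<^sub>R g m 0)) \<le> L * (t ^ Suc q / fact (Suc q))"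
  using assms
proof (induction q arbitrary: g t)
  case 0
  then show ?case by simp
next
  case (Suc q)
  define \<phi> where "\<phi> t = g 0 t - (\<Sum>m\<le>Suc q. (t ^ m / fact m) *\<^sub>R g m 0)" for t
  define \<phi>' where "\<phi>' t = g 1 t - (\<Sum>m\<le>q. (t ^ m / fact m) *\<^sub>R g (Suc m) 0)" for t
  define \<psi> where "\<psi> t = L * (t ^ Suc (Suc q) / fact (Suc (Suc q)))" for t :: real
  define \<psi>' where "\<psi>' t = L * (t ^ Suc q / fact (Suc q))" for t :: real
  have pow: "((\<lambda>t. t ^ Suc m / fact (Suc m)) has_vector_derivative (t ^ m / fact m)) (at t)"
    for m and t :: real
    unfolding has_real_derivative_iff_has_vector_derivative[symmetric]
    by (rule derivative_eq_intros refl | simp add: divide_simps del: of_nat_Suc)+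
  \<comment> \<open>The constant term is split off, so that the remaining powers have positive
    exponent and each drops to its predecessor.\<close>
  have d\<phi>: "(\<phi> has_vector_derivative \<phi>' t) (at t)" for t
  proof -
    have "((\<lambda>t. g 0 t - (g 0 0 + (\<Sum>m\<le>q. (t ^ Suc m / fact (Suc m)) *\<^sub>R g (Suc m) 0)))
        has_vector_derivative g 1 t - (0 + (\<Sum>m\<le>q. (t ^ m / fact m) *\<^sub>R g (Suc m) 0))) (at t)"
      using Suc.prems(1)[of 0 t]
      by (intro has_vector_derivative_diff has_vector_derivative_add has_vector_derivative_const
          has_vector_derivative_sum
          bounded_linear.has_vector_derivative[OF bounded_linear_scaleR_left] pow) auto
    moreover have "\<phi> = (\<lambda>t. g 0 t - (g 0 0 + (\<Sum>m\<le>q. (t ^ Suc m / fact (Suc m)) *\<^sub>R g (Suc m) 0)))"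
      unfolding \<phi>_def by (subst sum.atMost_Suc_shift) simp
    ultimately show ?thesis by (simp add: \<phi>'_def)
  qed
  have d\<psi>: "(\<psi> has_vector_derivative \<psi>' t) (at t)" for t
    unfolding \<psi>_def \<psi>'_def by (intro has_vector_derivative_mult_right pow)
  have bound: "norm (\<phi>' t) \<le> \<psi>' t" if "0 \<le> t" for t
    using Suc.IH[of "\<lambda>m. g (Suc m)" t] Suc.prems that unfolding \<phi>'_def \<psi>'_def by auto
  \<comment> \<open>The mean value inequality asks for a nondegenerate interval, so t = 0 is
    separate.\<close>
  have "norm (\<phi> t - \<phi> 0) \<le> \<psi> t - \<psi> 0"
  proof (cases "t = 0")
    case False
    then have "0 < t" using Suc.prems(3) by simp
    moreover have "continuous_on {0..t} \<phi>" "continuous_on {0..t} \<psi>"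
      using d\<phi> d\<psi>
      by (meson continuous_at_imp_continuous_on has_vector_derivative_continuous)+
    ultimately show ?thesis
      by (rule differentiable_bound_general[where \<phi>' = \<psi>' and f' = \<phi>']) (auto intro: d\<phi> d\<psi> bound)
  qed simp
  moreover have "\<phi> 0 = 0" unfolding \<phi>_def by (subst sum.atMost_Suc_shift) simp
  ultimately show ?case by (simp add: \<phi>_def \<psi>_def)
qed

text \<open>The one-dimensional bound is applied to the derivatives of \<open>F\<close> along the
  ray from v in the unit direction u, all evaluated at copies of u.\<close>

lemma nth_deriv_taylor_bound:
  fixes F :: "'a::euclidean_space \<Rightarrow> 'b::real_normed_vector"
  assumes diff: "times_differentiable q F"
    and lip: "\<And>x x'. multi_onorm q (\<lambda>hs. nth_deriv F q x' hs - nth_deriv F q x hs) \<le> L * norm (x' - x)"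
    and u: "norm u = 1" and t: "0 \<le> t"
  shows "norm (F (v + t *\<^sub>R u) - (\<Sum>m\<le>q. (t ^ m / fact m) *\<^sub>R nth_deriv F m v (replicate m u)))
           \<le> L * (t ^ Suc q / fact (Suc q))"
proof -
  define g where "g m t = nth_deriv F m (v + t *\<^sub>R u) (replicate m u)" for m t
  have "(g m has_vector_derivative g (Suc m) t) (at t)" if "m < q" for m t
  proof -
    let ?D = "\<lambda>h. nth_deriv F (Suc m) (v + t *\<^sub>R u) (h # replicate m u)"
    have D: "((\<lambda>y. nth_deriv F m y (replicate m u)) has_derivative ?D) (at (v + t *\<^sub>R u))"
      by (rule has_derivative_nth_deriv[OF diff that]) (auto simp: u)
    have "((\<lambda>s. v + s *\<^sub>R u) has_derivative (\<lambda>s. s *\<^sub>R u)) (at t)"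
      by (auto intro!: derivative_eq_intros)
    from has_derivative_compose[OF this D]
    have "(g m has_derivative (\<lambda>s. ?D (s *\<^sub>R u))) (at t)"
      unfolding g_def .
    moreover have "(\<lambda>s. ?D (s *\<^sub>R u)) = (\<lambda>s. s *\<^sub>R g (Suc m) t)"
      using linear_scale[OF has_derivative_linear[OF D]] by (simp add: g_def fun_eq_iff del: nth_deriv.simps)
    ultimately show ?thesis by (simp add: has_vector_derivative_def)
  qed
  moreover have "norm (g q t - g q 0) \<le> L * t" if "0 \<le> t" for t
  proof -
    have "norm (g q t - g q 0) \<le> multi_onorm q (\<lambda>hs. nth_deriv F q (v + t *\<^sub>R u) hs - nth_deriv F q v hs)"
      unfolding g_def using multilinear_nth_deriv[OF diff order_refl]
      by (subst scaleR_zero_left, subst add_0_right,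
          intro norm_le_multi_onorm[where T = "\<lambda>hs. nth_deriv F q (v + t *\<^sub>R u) hs - nth_deriv F q v hs"]
            multilinear_diff) (auto simp: u)
    also have "\<dots> \<le> L * t" using lip[of "v + t *\<^sub>R u" v] u that by simp
    finally show ?thesis .
  qed
  ultimately show ?thesis using vector_taylor_bound[of q g L t] t by (simp add: g_def)
qed

lemma strongly_lipschitz_step:
  fixes F :: "'a::euclidean_space \<Rightarrow> 'a"
  assumes p: "p \<ge> 1" and L: "L \<ge> 0" and lip: "strongly_lipschitz p L F" and \<gamma>: "0 < \<gamma>" "\<gamma> \<le> 1"
  shows "norm (F (v - (\<gamma> * norm (F v) powr (1 / real p - 1)) *\<^sub>R F v) - F v)
           \<le> \<gamma> * L * c_const p * norm (F v)"
proof (cases "F v = 0")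
  case False
  obtain q where q: "p = Suc q" using p by (cases p) auto
  define n where "n = norm (F v)"
  define N where "N = n powr (1 / real p)"
  \<comment> \<open>The minus sign turns the step into a forward move of length \<gamma> N along a
    unit vector.\<close>
  define u where "u = - (1 / n) *\<^sub>R F v"
  have n: "n > 0" using False by (simp add: n_def)
  have N: "N > 0" using n by (simp add: N_def)
  have Np: "N ^ p = n" using n p by (simp add: N_def powr_powr flip: powr_realpow)
  have u: "norm u = 1" using n by (simp add: u_def n_def)
  have step: "v - (\<gamma> * norm (F v) powr (1 / real p - 1)) *\<^sub>R F v = v + (\<gamma> * N) *\<^sub>R u"
    using n by (simp add: u_def N_def n_def[symmetric] powr_diff)
  have diff: "times_differentiable q F" using lip by (simp add: strongly_lipschitz_def q)
  define A where "A m = ((\<gamma> * N) ^ m / fact m) *\<^sub>R nth_deriv F m v (replicate m u)" for m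
  have A: "norm (A m) \<le> \<gamma> * L * n * (1 / fact m)" if m: "m \<in> {1..q}" for m
  proof -
    have "nth_deriv F m v (replicate m u) = (- (1 / n)) ^ m *\<^sub>R nth_deriv F m v (replicate m (F v))"
      using multilinear_map_scaleR[OF multilinear_nth_deriv[OF diff, of m v], of "replicate m (F v)" "- (1 / n)"] m
      by (simp add: u_def)
    then have "norm (A m) = (\<gamma> * N) ^ m / fact m / n ^ m * norm (nth_deriv F m v (replicate m (F v)))"
      using n N \<gamma> by (simp add: A_def power_abs power_divide abs_mult)
    also have "\<dots> \<le> (\<gamma> * N) ^ m / fact m / n ^ m * (L * n powr (real m + 1 - real m / real p))"
      using lip m n N \<gamma> unfolding strongly_lipschitz_def n_def
      by (intro mult_left_mono) (auto simp: q)
    \<comment> \<open>Since N is the p-th root of n, the factors \<open>N ^ m\<close> and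
      \<open>n ^ m\<close> cancel and every Taylor term is linear in n.\<close>
    also have "n powr (real m + 1 - real m / real p) = n ^ m * n / N ^ m"
      using n p by (simp add: powr_diff powr_add powr_realpow N_def powr_powr flip: powr_realpow)
    also have "(\<gamma> * N) ^ m / fact m / n ^ m * (L * (n ^ m * n / N ^ m)) = \<gamma> ^ m * (L * n * (1 / fact m))"
      using n N by (simp add: power_mult_distrib)
    also have "\<dots> \<le> \<gamma> * (L * n * (1 / fact m))"
      using power_decreasing[of 1 m \<gamma>] m \<gamma> L n by (intro mult_right_mono) auto
    finally show ?thesis by (simp add: mult.assoc)
  qed
  \<comment> \<open>The remainder supplies the summand m = p missing from the Taylor sum, which
    completes \<open>c_const p\<close>.\<close>
  have "norm (F (v + (\<gamma> * N) *\<^sub>R u) - (\<Sum>m\<le>q. A m)) \<le> L * ((\<gamma> * N) ^ Suc q / fact (Suc q))"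
    unfolding A_def using lip u \<gamma> N
    by (intro nth_deriv_taylor_bound diff) (auto simp: strongly_lipschitz_def q)
  also have "\<dots> = \<gamma> ^ p * (L * n * (1 / fact p))"
    using Np by (simp only: q power_mult_distrib) simp
  also have "\<dots> \<le> \<gamma> * (L * n * (1 / fact p))"
    using power_decreasing[of 1 p \<gamma>] p \<gamma> L n by (intro mult_right_mono) auto
  finally have rem: "norm (F (v + (\<gamma> * N) *\<^sub>R u) - (\<Sum>m\<le>q. A m)) \<le> \<gamma> * L * n * (1 / fact p)"
    by (simp add: mult.assoc)
  have split: "(\<Sum>m\<le>q. A m) = F v + (\<Sum>m=1..q. A m)"
    by (subst atMost_atLeast0, subst sum.atLeast_Suc_atMost) (simp_all add: A_def)
  have "norm (\<Sum>m=1..q. A m) \<le> (\<Sum>m=1..q. \<gamma> * L * n * (1 / fact m))"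
    by (rule sum_norm_le) (rule A)
  with rem split
  have "norm (F (v + (\<gamma> * N) *\<^sub>R u) - F v)
      \<le> (\<Sum>m=1..q. \<gamma> * L * n * (1 / fact m)) + \<gamma> * L * n * (1 / fact p)"
    using norm_triangle_ineq[of "F (v + (\<gamma> * N) *\<^sub>R u) - (\<Sum>m\<le>q. A m)" "\<Sum>m=1..q. A m"]
    by (simp add: algebra_simps)
  also have "\<dots> = \<gamma> * L * n * c_const p"
    by (simp add: c_const_def q sum_distrib_left distrib_left)
  finally show ?thesis unfolding step by (simp add: n_def mult_ac)
qed simp

section \<open>Descent of the distance to a zero\<close>

lemma c_const_pos: "p \<ge> 1 \<Longrightarrow> c_const p > 0"
  unfolding c_const_def by (intro sum_pos) auto

text \<open>In the expansion of the square, v - z is split at x: monotonicity discards the part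
  along x - z, and closeness of g to \<theta> (v - x) bounds the other part below and the norm of g
  above.\<close>

lemma extragradient_descent:
  fixes v x z g :: "'a::real_inner"
  assumes err: "norm (g - \<theta> *\<^sub>R (v - x)) \<le> \<theta> * a * norm (v - x)"
    and mono: "g \<bullet> (x - z) \<ge> 0"
    and \<theta>: "0 \<le> \<theta>" "\<theta> * (1 + a) \<le> 1 / 2" and a: "0 \<le> a" "a \<le> 1 / 2"
  shows "(norm (v - g - z))\<^sup>2 \<le> (norm (v - z))\<^sup>2 - \<theta> / 4 * (norm (v - x))\<^sup>2"
proof -
  define r where "r = norm (v - x)"
  define e where "e = g - \<theta> *\<^sub>R (v - x)"
  have g: "g = \<theta> *\<^sub>R (v - x) + e" by (simp add: e_def)
  have r: "0 \<le> r" and e: "norm e \<le> \<theta> * a * r" using err by (simp_all add: r_def e_def)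
  have rr: "(v - x) \<bullet> (v - x) = r\<^sup>2" by (simp add: r_def power2_norm_eq_inner)
  have "\<bar>e \<bullet> (v - x)\<bar> \<le> norm e * r" unfolding r_def by (rule Cauchy_Schwarz_ineq2)
  also have "\<dots> \<le> \<theta> * a * r * r" by (intro mult_right_mono e r)
  finally have "g \<bullet> (v - x) \<ge> \<theta> * r\<^sup>2 - \<theta> * a * r\<^sup>2"
    unfolding g inner_add_left inner_scaleR_left rr by (simp add: power2_eq_square)
  moreover have "g \<bullet> (v - z) = g \<bullet> (v - x) + g \<bullet> (x - z)" by (simp add: inner_diff_right)
  ultimately have lin: "g \<bullet> (v - z) \<ge> \<theta> * r\<^sup>2 - \<theta> * a * r\<^sup>2" using mono by linarith
  have "norm g \<le> \<theta> * (1 + a) * r"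
    using norm_triangle_ineq[of "\<theta> *\<^sub>R (v - x)" e] e \<theta>(1) unfolding g
    by (simp add: r_def[symmetric] distrib_left distrib_right)
  then have "(norm g)\<^sup>2 \<le> (\<theta> * (1 + a) * r)\<^sup>2" by (intro power_mono) auto
  also have "\<dots> = (\<theta> * (1 + a)) * (\<theta> * (1 + a) * r\<^sup>2)" by (simp add: power2_eq_square)
  also have "\<dots> \<le> 1 / 2 * (\<theta> * (1 + a) * r\<^sup>2)" using \<theta> a by (intro mult_right_mono) auto
  finally have quad: "(norm g)\<^sup>2 \<le> 1 / 2 * (\<theta> * (1 + a) * r\<^sup>2)" .
  have "(norm (v - g - z))\<^sup>2 = (norm (v - z))\<^sup>2 - 2 * (g \<bullet> (v - z)) + (norm g)\<^sup>2"
    unfolding power2_norm_eq_inner by (simp add: inner_diff_left inner_diff_right inner_commute)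
  also have "\<dots> \<le> (norm (v - z))\<^sup>2 - 2 * (\<theta> * r\<^sup>2 - \<theta> * a * r\<^sup>2) + 1 / 2 * (\<theta> * (1 + a) * r\<^sup>2)"
    by (intro add_mono diff_mono mult_left_mono lin quad) auto
  \<comment> \<open>The total coefficient is -3\<theta>/2 + 5\<theta>a/2. Keeping -\<theta>/4 leaves
    a multiple of 1/2 - a, which has the right sign.\<close>
  also have "\<dots> = (norm (v - z))\<^sup>2 - \<theta> / 4 * r\<^sup>2 - 5 / 2 * (\<theta> * r\<^sup>2) * (1 / 2 - a)"
    by (simp add: field_simps)
  also have "\<dots> \<le> (norm (v - z))\<^sup>2 - \<theta> / 4 * r\<^sup>2"
    using \<theta> a by simp
  finally show ?thesis by (simp add: r_def)
qed

text \<open>An unstopped step is an instance of \<open>extragradient_descent\<close> with g =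
  \<lambda> F x'. Both conclusions are phrased through F at v = x0 + s: the second bounds the sum of
  these residuals, the first carries the result over to x'.\<close>

lemma fom_step_descent:
  fixes F :: "'a::euclidean_space \<Rightarrow> 'a"
  assumes p: "p \<ge> 1" and L: "L \<ge> 0" and mono: "monotone_operator F" and lip: "strongly_lipschitz p L F"
    and z: "F z = 0" and \<gamma>: "0 < \<gamma>" "\<gamma> \<le> 1" and a: "a = \<gamma> * L * c_const p" "a \<le> 1 / 2"
    and \<theta>: "\<eta> = \<theta> * \<gamma> ^ p" "0 \<le> \<theta>" "\<theta> * (1 + a) \<le> 1 / 2"
    and step: "fom_step p \<gamma> \<eta> F x0 (x, s) = (x', s')" and x: "F x \<noteq> 0"
  shows "norm (F x') \<le> (1 + a) * norm (F (x0 + s))"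
    and "(norm (x0 + s' - z))\<^sup>2
          \<le> (norm (x0 + s - z))\<^sup>2 - \<theta> / 4 * (\<gamma> * norm (F (x0 + s)) powr (1 / real p))\<^sup>2"
proof -
  define v where "v = x0 + s"
  define n where "n = norm (F v)"
  define N where "N = n powr (1 / real p)"
  define l where "l = \<eta> / norm (x' - v) ^ (p - 1)"
  have x': "x' = v - (\<gamma> * n powr (1 / real p - 1)) *\<^sub>R F v" and s': "s' = s - l *\<^sub>R F x'"
    using step x by (auto simp: fom_step_def Let_def l_def v_def n_def)
  have a0: "0 \<le> a" unfolding a(1) using \<gamma> L c_const_pos[OF p] by simp
  have close: "norm (F x' - F v) \<le> a * n"
    using strongly_lipschitz_step[OF p L lip \<gamma>, of v] by (simp add: x' n_def a(1))
  then show "norm (F x') \<le> (1 + a) * norm (F (x0 + s))"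
    using norm_triangle_ineq[of "F x' - F v" "F v"] by (simp add: n_def v_def algebra_simps)
  have "(norm (v - l *\<^sub>R F x' - z))\<^sup>2 \<le> (norm (v - z))\<^sup>2 - \<theta> / 4 * (\<gamma> * N)\<^sup>2"
  proof (cases "n = 0")
    \<comment> \<open>Here x' is also a zero and \<open>0 powr _\<close> is 0, so nothing moves and
      nothing has to be gained.\<close>
    case True
    then have "F x' = 0" using close by (simp add: n_def)
    then show ?thesis by (simp add: True N_def)
  next
    case False
    then have n: "n > 0" by (simp add: n_def)
    have N: "N > 0" using n by (simp add: N_def)
    have Np: "N ^ p = n" using n p by (simp add: N_def powr_powr flip: powr_realpow)
    have vx: "v - x' = (\<gamma> * N / n) *\<^sub>R F v" using n by (simp add: x' N_def powr_diff)
    then have r: "norm (v - x') = \<gamma> * N" using \<gamma> N n by (simp add: n_def)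
    \<comment> \<open>The exponent p - 1 in the definition of l leaves exactly one factor \<gamma>
      N, the step length.\<close>
    have "(\<gamma> * N) ^ p = (\<gamma> * N) ^ (p - 1) * (\<gamma> * N)" using p by (metis power_minus_mult less_eq_Suc_le One_nat_def)
    then have "\<gamma> ^ p * n = (\<gamma> * N) ^ (p - 1) * (\<gamma> * N)" by (simp add: power_mult_distrib Np)
    then have ln: "l * n = \<theta> * (\<gamma> * N)"
      unfolding l_def norm_minus_commute[of x'] r \<theta>(1) using \<gamma> N by (simp add: field_simps)
    then have l: "l = \<theta> * (\<gamma> * N / n)" using n by (simp add: field_simps)
    have l0: "l \<ge> 0" unfolding l using \<theta> \<gamma> N n by simp
    have "l *\<^sub>R F x' - \<theta> *\<^sub>R (v - x') = l *\<^sub>R (F x' - F v)"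
      by (simp add: vx l scaleR_diff_right)
    then have "norm (l *\<^sub>R F x' - \<theta> *\<^sub>R (v - x')) = l * norm (F x' - F v)" using l0 by simp
    also have "\<dots> \<le> l * (a * n)" by (intro mult_left_mono close l0)
    also have "\<dots> = \<theta> * a * norm (v - x')" using ln by (simp add: r mult.left_commute mult.assoc)
    finally have err: "norm (l *\<^sub>R F x' - \<theta> *\<^sub>R (v - x')) \<le> \<theta> * a * norm (v - x')" .
    have "F x' \<bullet> (x' - z) \<ge> 0" using mono z unfolding monotone_operator_def by (metis diff_zero)
    then have "l *\<^sub>R F x' \<bullet> (x' - z) \<ge> 0" using l0 by simp
    from extragradient_descent[OF err this \<theta>(2,3) a0 a(2)] show ?thesis by (simp add: r)
  qed
  then show "(norm (x0 + s' - z))\<^sup>2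
      \<le> (norm (x0 + s - z))\<^sup>2 - \<theta> / 4 * (\<gamma> * norm (F (x0 + s)) powr (1 / real p))\<^sup>2"
    by (simp add: s' v_def N_def n_def algebra_simps)
qed

section \<open>From summable residuals to the rate\<close>

theorem theorem3p4:
  fixes F :: "real ^ 'n \<Rightarrow> real ^ 'n"
    and p :: nat
    and L \<gamma> \<eta>\<^sub>2 :: real
    and x0 :: "real ^ 'n"
  assumes "p \<ge> 1"
    and "L > 0"
    and "monotone_operator F"
    and "strongly_lipschitz p L F"
    and "\<exists>x. F x = 0"
    and "0 < \<gamma>"
    and "\<gamma> < min 1 (1 / (2 * L * c_const p))"
    and "\<gamma> ^ p / (6 - 6 * \<gamma> * L * c_const p) \<le> \<eta>\<^sub>2"
    and "\<eta>\<^sub>2 \<le> \<gamma> ^ p / (2 + 2 * \<gamma> * L * c_const p)"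
  shows "\<exists>C>0. \<forall>k\<ge>1. (INF i\<in>{0..k}. norm (F (fom_iterate p \<gamma> \<eta>\<^sub>2 F x0 i)))
                        \<le> C * real k powr (- real p / 2)"
proof -
  obtain z where z: "F z = 0" using assms(5) by blast
  define a where "a = \<gamma> * L * c_const p"
  define \<theta> where "\<theta> = \<eta>\<^sub>2 / \<gamma> ^ p"
  \<comment> \<open>The factor 4 / (\<theta> \<gamma>^2) inverts the coefficient in
    \<open>\<rho>\<close>; the added 1 keeps M positive even if x0 = z.\<close>
  define M where "M = (4 * (norm (x0 - z))\<^sup>2 + 1) / (\<theta> * \<gamma>\<^sup>2)"
  have c: "c_const p > 0" by (rule c_const_pos[OF assms(1)])
  have a: "0 < a" "a < 1 / 2"
    using assms(2,6,7) c by (simp_all add: a_def field_simps)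
  have \<gamma>: "0 < \<gamma>" "\<gamma> \<le> 1" using assms(6,7) by auto
  \<comment> \<open>The denominator is 6 - 6a > 3, so the lower bound on
    \<open>\<eta>\<^sub>2\<close> makes it positive.\<close>
  have "0 < \<gamma> ^ p / (6 - 6 * \<gamma> * L * c_const p)"
    using a \<gamma> by (intro divide_pos_pos) (auto simp: a_def mult.assoc)
  then have \<eta>: "0 < \<eta>\<^sub>2" using assms(8) by linarith
  have \<theta>: "0 < \<theta>" using \<eta> \<gamma> by (simp add: \<theta>_def)
  have \<eta>_eq: "\<eta>\<^sub>2 = \<theta> * \<gamma> ^ p" using \<gamma> by (simp add: \<theta>_def)
  \<comment> \<open>The upper bound on \<open>\<eta>\<^sub>2\<close> is exactly \<theta> (1 + a)
    \<le> 1/2.\<close>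
  have "\<eta>\<^sub>2 \<le> \<gamma> ^ p / (2 + 2 * a)" using assms(9) by (simp add: a_def mult.assoc)
  then have \<theta>a: "\<theta> * (1 + a) \<le> 1 / 2" using a \<gamma> by (simp add: \<theta>_def field_simps)
  have M: "M > 0" unfolding M_def using \<theta> \<gamma> by (intro divide_pos_pos add_nonneg_pos) auto
  define x where "x i = fom_iterate p \<gamma> \<eta>\<^sub>2 F x0 i" for i
  \<comment> \<open>Index shift: \<open>v i\<close> is the point from which x (i+1) is
    computed.\<close>
  define v where "v i = x0 + snd (fom_state p \<gamma> \<eta>\<^sub>2 F x0 i)" for i
  define \<rho> where "\<rho> i = \<theta> / 4 * (\<gamma> * norm (F (v i)) powr (1 / real p))\<^sup>2" for i
  have desc: "norm (F (x (Suc i))) \<le> (1 + a) * norm (F (v i))"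
      "(norm (v (Suc i) - z))\<^sup>2 \<le> (norm (v i - z))\<^sup>2 - \<rho> i" if "F (x i) \<noteq> 0" for i
  proof -
    have "fom_step p \<gamma> \<eta>\<^sub>2 F x0 (x i, snd (fom_state p \<gamma> \<eta>\<^sub>2 F x0 i))
        = (x (Suc i), snd (fom_state p \<gamma> \<eta>\<^sub>2 F x0 (Suc i)))"
      by (simp add: x_def fom_iterate_def)
    note * = fom_step_descent[OF assms(1) less_imp_le[OF assms(2)] assms(3,4) z \<gamma> a_def
        less_imp_le[OF a(2)] \<eta>_eq less_imp_le[OF \<theta>] \<theta>a this that]
    show "norm (F (x (Suc i))) \<le> (1 + a) * norm (F (v i))"
      "(norm (v (Suc i) - z))\<^sup>2 \<le> (norm (v i - z))\<^sup>2 - \<rho> i"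
      using * by (simp_all add: v_def \<rho>_def)
  qed
  have "(INF i\<in>{0..k}. norm (F (x i))) \<le> ((1 + a) * M powr (real p / 2)) * real k powr (- real p / 2)"
    (is "?\<delta> \<le> _") if k: "k \<ge> 1" for k
  proof -
    have \<delta>_le: "?\<delta> \<le> norm (F (x i))" if "i \<le> k" for i
      using that by (intro cINF_lower) auto
    show ?thesis
    proof (cases "\<exists>i\<le>k. F (x i) = 0")
      case True
      then have "?\<delta> \<le> 0" using \<delta>_le by fastforce
      also have "0 \<le> ((1 + a) * M powr (real p / 2)) * real k powr (- real p / 2)" using a by simp
      finally show ?thesis .
    next
      case False
      \<comment> \<open>Telescoping from v 0 = x0; no iterate up to k is a zero, so every step is a
        genuine one.\<close>
      have sum: "(norm (v j - z))\<^sup>2 \<le> (norm (x0 - z))\<^sup>2 - (\<Sum>i<j. \<rho> i)" if "j \<le> k" for j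
        using that
      proof (induction j)
        case 0
        then show ?case by (simp add: v_def)
      next
        case (Suc j)
        then show ?case using desc(2)[of j] False by fastforce
      qed
      \<comment> \<open>Each x (i+1) with i < k counts in the infimum, so d lies below the residual
        at every such \<open>v i\<close>, and each of the k gains is at least the one computed from
        d.\<close>
      define d where "d = ?\<delta> / (1 + a)"
      have "?\<delta> \<ge> 0" by (intro cINF_greatest) auto
      then have d: "d \<ge> 0" using a by (simp add: d_def)
      have "\<theta> / 4 * (\<gamma> * d powr (1 / real p))\<^sup>2 \<le> \<rho> i" if "i < k" for i
      proof -
        have "?\<delta> \<le> (1 + a) * norm (F (v i))"
          using \<delta>_le[of "Suc i"] desc(1)[of i] False that by fastforce
        then have "d \<le> norm (F (v i))" using a by (simp add: d_def field_simps)
        then show ?thesis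
          unfolding \<rho>_def using d \<theta> \<gamma>
          by (intro mult_left_mono power_mono powr_mono2) auto
      qed
      then have "real k * (\<theta> / 4 * (\<gamma> * d powr (1 / real p))\<^sup>2) \<le> (\<Sum>i<k. \<rho> i)"
        using sum_bounded_below[of "{..<k}" "\<theta> / 4 * (\<gamma> * d powr (1 / real p))\<^sup>2" \<rho>] by simp
      also have "\<dots> \<le> (norm (x0 - z))\<^sup>2"
        using sum[OF order_refl] zero_le_power2[of "norm (v k - z)"] by linarith
      finally have "(d powr (1 / real p))\<^sup>2 \<le> M / real k"
        using k \<theta> \<gamma> by (simp add: M_def power_mult_distrib field_simps)
      then have "((d powr (1 / real p))\<^sup>2) powr (real p / 2) \<le> (M / real k) powr (real p / 2)"
        by (intro powr_mono2) auto
      also have "((d powr (1 / real p))\<^sup>2) powr (real p / 2) = d"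
        using d assms(1) by (cases "d = 0") (simp_all add: powr_powr flip: powr_realpow)
      also have "(M / real k) powr (real p / 2) = M powr (real p / 2) * real k powr (- real p / 2)"
        using M k by (simp add: powr_divide powr_minus_divide)
      finally show ?thesis using a by (simp add: d_def field_simps)
    qed
  qed
  moreover have "(1 + a) * M powr (real p / 2) > 0" using a M by simp
  ultimately show ?thesis unfolding x_def by blast
qed

end
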